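(* Let $p$ be a prime, $q=p^r>2$, let $\beta$ be a generator of $\mathbb{F}_q^*$, let $m$ be an integer with $1<m<q-1$, coprime with $q-1$, and with $m\not\equiv p^l\pmod{q-1}$ for all $l\in\{0,\ldots,r-1\}$, and let $c\in\mathbb{F}_q^*$ be such that $x^m-x+\frac{c}{1-\beta}=0$ has no solution in $\mathbb{F}_q$. Let $Q=\mathbb{F}_q$ with $x\ast y=(1-\beta)x^m+\beta y+c$. Then the number of associative triples in $Q$, i.e. triples $(x,y,z)\in Q^3$ with $(x\ast y)\ast z=x\ast(y\ast z)$, equals $q^2=|Q|^2$. *)

theory Defs
  imports Complex_Main "HOL-Number_Theory.Cong"
begin

text \<open>The equation excludes \<open>\<beta> = 0\<close>, since \<open>0 powi 1 = 0\<close>.\<close>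

definition generates_units :: "'a::field \<Rightarrow> bool" where
  "generates_units \<beta> \<longleftrightarrow> range (\<lambda>k::int. \<beta> powi k) = UNIV - {0}"

definition quasigroup_op :: "'a::field \<Rightarrow> nat \<Rightarrow> 'a \<Rightarrow> 'a \<Rightarrow> 'a \<Rightarrow> 'a" where
  "quasigroup_op \<beta> m c x y = (1 - \<beta>) * x ^ m + \<beta> * y + c"

definition associative_triples :: "('a \<Rightarrow> 'a \<Rightarrow> 'a) \<Rightarrow> ('a \<times> 'a \<times> 'a) set" where
  "associative_triples f = {(x, y, z). f (f x y) z = f x (f y z)}"

end

theory Submission
  imports Defs
begin

text \<open>The equation \<open>(x * y) * z = x * (y * z)\<close> is affine in \<open>z\<close>, and the coefficient of \<open>z\<close> is
  \<open>\<beta> (1 - \<beta>)\<close>. It is nonzero since \<open>\<beta>\<close> generates a group with more than one element, so that each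
  pair \<open>(x, y)\<close> extends to exactly one associative triple.\<close>

lemma generates_units_neq_0:
  assumes "generates_units \<beta>"
  shows "\<beta> \<noteq> 0"
proof -
  have "\<beta> powi 1 \<in> UNIV - {0}"
    using assms unfolding generates_units_def by blast
  then show ?thesis by simp
qed

lemma generates_units_neq_1:
  fixes \<beta> :: "'a::{field,finite}"
  assumes "generates_units \<beta>" and "card (UNIV :: 'a set) > 2"
  shows "\<beta> \<noteq> 1"
proof
  assume "\<beta> = 1"
  \<comment> \<open>Every integer power of 1 is 1, so 1 would be the only nonzero element.\<close>
  then have "UNIV - {0} = {1 :: 'a}"
    using assms(1) by (auto simp: generates_units_def)
  then have "card (UNIV - {0 :: 'a}) = 1" by simp
  with assms(2) show False by (simp add: card_Diff_singleton)
qed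

text \<open>Only left arguments are raised to the power m, and z always stands on the right. So z
  enters linearly, with coefficient \<beta> on one side and \<beta>^2 on the other; collecting terms
  and dividing by the difference isolates z.\<close>

lemma quasigroup_op_assoc_iff:
  fixes \<beta> c x y z :: "'a::field"
  assumes "\<beta> \<noteq> 0" and "\<beta> \<noteq> 1"
  shows "quasigroup_op \<beta> m c (quasigroup_op \<beta> m c x y) z
           = quasigroup_op \<beta> m c x (quasigroup_op \<beta> m c y z)
         \<longleftrightarrow> z = ((1 - \<beta>) * (x ^ m + \<beta> * y ^ m - quasigroup_op \<beta> m c x y ^ m) + \<beta> * c)
                 / (\<beta> * (1 - \<beta>))"
proof -
  have "\<beta> * (1 - \<beta>) \<noteq> 0" using assms by simp
  then show ?thesis
    unfolding eq_divide_eq by (auto simp: quasigroup_op_def algebra_simps)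
qed

lemma card_associative_triples:
  fixes \<beta> c :: "'a::{field,finite}"
  assumes "\<beta> \<noteq> 0" and "\<beta> \<noteq> 1"
  shows "card (associative_triples (quasigroup_op \<beta> m c)) = card (UNIV :: 'a set) ^ 2"
proof -
  define t where "t x y = ((1 - \<beta>) * (x ^ m + \<beta> * y ^ m - quasigroup_op \<beta> m c x y ^ m) + \<beta> * c)
                 / (\<beta> * (1 - \<beta>))" for x y
  \<comment> \<open>The triples form the graph of \<open>t\<close>, hence are as many as the
    pairs.\<close>
  have "associative_triples (quasigroup_op \<beta> m c) = range (\<lambda>(x, y). (x, y, t x y))"
    unfolding associative_triples_def quasigroup_op_assoc_iff[OF assms] t_def by auto
  moreover have "inj (\<lambda>(x, y). (x, y, t x y))"
    by (auto intro!: injI)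
  ultimately have "card (associative_triples (quasigroup_op \<beta> m c)) = card (UNIV :: ('a \<times> 'a) set)"
    by (simp add: card_image)
  then show ?thesis
    \<comment> \<open>The flipped rule turns the universe of pairs into a product of sets, whose
      cardinality is known.\<close>
    by (simp add: card_cartesian_product power2_eq_square flip: UNIV_Times_UNIV)
qed

theorem theorem8:
  fixes p q r m :: nat and \<beta> c :: "'a::{field,finite}"
  assumes "prime p" and "q = p ^ r" and "q > 2"
    and "card (UNIV :: 'a set) = q"
    and "generates_units \<beta>"
    and "1 < m" and "m < q - 1" and "coprime m (q - 1)"
    and "\<forall>l\<in>{..<r}. \<not> [m = p ^ l] (mod (q - 1))"
    and "c \<noteq> 0"
    and "\<not> (\<exists>x::'a. x ^ m - x + c / (1 - \<beta>) = 0)"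
  shows "card (associative_triples (quasigroup_op \<beta> m c)) = q ^ 2"
  using card_associative_triples generates_units_neq_0 generates_units_neq_1 assms(3-5) by metis

end
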